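(* Let $X$ be a Bernoulli random variable with $\Pr\{X=1\}=1-\Pr\{X=0\}=p\in(0,1)$ and let $X_1,X_2,\dots$ be i.i.d. samples of $X$. Let $0<\delta<1$ and let $0<\varepsilon_a<\varepsilon_r<1$ be such that $\frac{\varepsilon_a}{\varepsilon_r}+\varepsilon_a\le\frac12$. Put $p^\star=\frac{\varepsilon_a}{\varepsilon_r}$. Let $\gamma$ and $n$ be positive integers with $$n>\frac{\ln(\delta/2)}{\mathscr{M}_{\mathrm{B}}(p^\star+\varepsilon_a,p^\star)},\qquad \gamma>\frac{\ln(\delta/2)}{\mathscr{M}_{\mathrm{I}}(p^\star+\varepsilon_a,p^\star)},$$ and let $\widehat{p}$ be the truncated inverse sampling estimator with threshold $\gamma$ and maximum sample size $n$. Then $$\Pr\left\{|\widehat{p}-p|<\varepsilon_a\ \text{ or }\ \left|\frac{\widehat{p}-p}{p}\right|<\varepsilon_r\right\}>1-\delta.$$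
   Context: Truncated inverse sampling with positive integer threshold $\gamma$ and maximum sample size $n$: the (random) number of samples is $\mathbf{n}=\min\{n,\ \min\{\ell\in\mathbb{N}:\sum_{i=1}^{\ell}X_i\ge\gamma\}\}$ (minimum of the empty set is $+\infty$), $\mathbf{k}=\sum_{i=1}^{\mathbf{n}}X_i$, and the estimator is $\widehat{p}=\min\{\mathbf{k},\gamma\}/\mathbf{n}=\mathbf{k}/\mathbf{n}$. For $0<z<1$ and $0<\mu<1$, $$\mathscr{M}_{\mathrm{B}}(z,\mu)=z\ln\left(\frac{\mu}{z}\right)+(1-z)\ln\left(\frac{1-\mu}{1-z}\right),\qquad \mathscr{M}_{\mathrm{I}}(z,\mu)=\frac1z\mathscr{M}_{\mathrm{B}}(z,\mu).$$ *)

theory Defs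
  imports "HOL-Probability.Probability" "HOL-Library.Extended_Nat"
begin

text \<open>\<open>M_B\<close> and \<open>M_I\<close> are meaningful for arguments strictly between 0 and 1 only.\<close>

definition M_B :: "real \<Rightarrow> real \<Rightarrow> real" where
  "M_B z \<mu> = z * ln (\<mu> / z) + (1 - z) * ln ((1 - \<mu>) / (1 - z))"

definition M_I :: "real \<Rightarrow> real \<Rightarrow> real" where
  "M_I z \<mu> = M_B z \<mu> / z"

text \<open>
  In the following, \<open>x\<close> is a realisation \<open>x 1, x 2, \<dots>\<close> of the sample sequence (\<open>x 0\<close> is never
  used), \<open>\<gamma>\<close> is the threshold and \<open>n\<close> the maximum sample size. The infimum of the empty set in
  \<^typ>\<open>enat\<close> is \<open>\<infinity>\<close>, and the outer minimum is at most \<open>n\<close>, so \<^const>\<open>the_enat\<close> is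
  applied to a finite value only.
\<close>

definition sample_number :: "nat \<Rightarrow> nat \<Rightarrow> (nat \<Rightarrow> real) \<Rightarrow> nat" where
  "sample_number \<gamma> n x =
     the_enat (min (enat n) (Inf {enat l | l. l \<ge> 1 \<and> (\<Sum>i=1..l. x i) \<ge> real \<gamma>}))"

definition sample_sum :: "nat \<Rightarrow> nat \<Rightarrow> (nat \<Rightarrow> real) \<Rightarrow> real" where
  "sample_sum \<gamma> n x = (\<Sum>i=1..sample_number \<gamma> n x. x i)"

definition trunc_inv_estimator :: "nat \<Rightarrow> nat \<Rightarrow> (nat \<Rightarrow> real) \<Rightarrow> real" where
  "trunc_inv_estimator \<gamma> n x = min (sample_sum \<gamma> n x) (real \<gamma>) / real (sample_number \<gamma> n x)"

text \<open>For samples with values 0 and 1 the minimum in the estimator is redundant.\<close>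

lemma trunc_inv_estimator_eq:
  assumes "\<gamma> \<ge> 1" and x: "\<And>i. i \<ge> 1 \<Longrightarrow> x i \<in> {0, 1}"
  shows "trunc_inv_estimator \<gamma> n x = sample_sum \<gamma> n x / real (sample_number \<gamma> n x)"
proof -
  have "sample_sum \<gamma> n x \<le> real \<gamma>"
  proof (cases "sample_number \<gamma> n x")
    case 0
    then show ?thesis by (simp add: sample_sum_def)
  next
    case (Suc m)
    let ?S = "{enat l | l. l \<ge> 1 \<and> (\<Sum>i=1..l. x i) \<ge> real \<gamma>}"
    obtain k where k: "min (enat n) (Inf ?S) = enat k"
      by (rule enat_ile[OF min.cobounded1, THEN exE])
    from Suc have "k = Suc m"
      unfolding sample_number_def k by simp
    with k have eq: "min (enat n) (Inf ?S) = enat (Suc m)"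
      by simp
    have "(\<Sum>i=1..m. x i) \<le> real \<gamma> - 1" if m: "m \<ge> 1"
    proof -
      have "(\<Sum>i=1..m. x i) < real \<gamma>"
      proof (rule ccontr)
        assume "\<not> (\<Sum>i=1..m. x i) < real \<gamma>"
        with m have "enat m \<in> ?S" by auto
        then have "Inf ?S \<le> enat m" by (rule Inf_lower)
        moreover have "enat (Suc m) \<le> Inf ?S"
          unfolding eq[symmetric] by (rule min.cobounded2)
        ultimately have "enat (Suc m) \<le> enat m" by (rule order_trans[rotated])
        then show False by simp
      qed
      moreover have "(\<Sum>i=1..m. x i) \<in> \<int>"
        using x by (intro Ints_sum) fastforce
      then obtain k where "(\<Sum>i=1..m. x i) = of_int k" by (rule Ints_cases)
      ultimately have "of_int k < real \<gamma>" and eqk: "(\<Sum>i=1..m. x i) = of_int k" by simp_all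
      then have "k < int \<gamma>" by linarith
      then show ?thesis unfolding eqk by linarith
    qed
    moreover have "x (Suc m) \<le> 1" using x[of "Suc m"] by auto
    ultimately have "(\<Sum>i=1..Suc m. x i) \<le> real \<gamma>"
      using \<open>\<gamma> \<ge> 1\<close> by (cases "m = 0") auto
    with Suc show ?thesis by (simp add: sample_sum_def)
  qed
  then show ?thesis by (simp add: trunc_inv_estimator_def)
qed

end

theory Submission
  imports Defs
begin

text \<open>
  Let \<open>q = pstar\<close> and \<open>z0 = q + \<epsilon>\<^sub>a\<close>, and let \<open>t\<close> be the optimal
  Chernoff exponent for the pair \<open>(z0, q)\<close>, so that \<open>t z0 - ln (1 + q (exp t - 1)) = - M_B z0 q\<close>.
  The same \<open>t\<close> (and \<open>- t\<close> for the lower tail) works for every \<open>p\<close>.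
  Both tails of the estimator, at a level \<open>z\<close>, reduce to a tail of a single partial sum: the one of length
  \<open>n\<close> if \<open>n z \<le> \<gamma>\<close>, and otherwise the one of length \<open>\<gamma> / z\<close>, rounded
  down (upper tail) or up (lower tail). The resulting exponents are compared with those at
  \<open>q\<close>. If \<open>p \<ge> q\<close>, the relative error is decisive, and concavity of \<open>ln\<close> makes
  \<open>ln (1 + p c) / p\<close> decreasing in \<open>p\<close>. If \<open>p \<le> q\<close>, the absolute error is
  decisive, and \<open>z0 \<le> 1/2\<close> makes the exponent at deviation \<open>\<epsilon>\<^sub>a\<close> decrease in
  \<open>p\<close>. Lower tails are lighter than upper tails, since a Bernoulli law with success
  probability at most \<open>1/2\<close> is skewed to the right.
\<close>

section \<open>Pathwise analysis of the stopping rule\<close>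

text \<open>Inserting \<open>n\<close> into the set of stopping times absorbs the outer minimum and
  makes the set nonempty, so the infimum in \<open>enat\<close> is attained. The
  \<open>LEAST\<close> form gives access to \<open>LeastI\<close> and to measurability.\<close>

lemma sample_number_eq_Least:
  assumes "n \<ge> 1"
  shows "sample_number \<gamma> n x = (LEAST l. l \<ge> 1 \<and> (l = n \<or> (\<Sum>i=1..l. x i) \<ge> real \<gamma>))"
proof -
  define S where "S = {l. l \<ge> 1 \<and> (\<Sum>i=1..l. x i) \<ge> real \<gamma>}"
  have *: "{enat l | l. l \<ge> 1 \<and> (\<Sum>i=1..l. x i) \<ge> real \<gamma>} = enat ` S"
    by (auto simp: S_def)
  have ins: "min (enat n) (Inf (enat ` S)) = Inf (enat ` insert n S)"
    by (simp add: inf_min)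
  define N where "N = (LEAST l. l \<in> insert n S)"
  have N: "N \<in> insert n S" unfolding N_def by (rule LeastI[of _ n]) simp
  have "Inf (enat ` insert n S) = enat N"
  proof (rule antisym)
    show "Inf (enat ` insert n S) \<le> enat N" using N by (intro Inf_lower) auto
    show "enat N \<le> Inf (enat ` insert n S)"
    proof (rule Inf_greatest)
      fix y assume "y \<in> enat ` insert n S"
      then obtain l where "l \<in> insert n S" "y = enat l" by blast
      then show "enat N \<le> y" unfolding N_def by (auto intro: Least_le)
    qed
  qed
  then have "sample_number \<gamma> n x = N"
    unfolding sample_number_def * ins by simp
  also have "N = (LEAST l. l \<ge> 1 \<and> (l = n \<or> (\<Sum>i=1..l. x i) \<ge> real \<gamma>))"
    unfolding N_def S_def using assms by (intro arg_cong[where f=Least] ext) auto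
  finally show ?thesis .
qed

lemma sample_number_bounds:
  assumes "n \<ge> 1"
  shows "1 \<le> sample_number \<gamma> n x" "sample_number \<gamma> n x \<le> n"
    "sample_number \<gamma> n x < n \<Longrightarrow> real \<gamma> \<le> sample_sum \<gamma> n x"
proof -
  let ?P = "\<lambda>l. l \<ge> 1 \<and> (l = n \<or> (\<Sum>i=1..l. x i) \<ge> real \<gamma>)"
  note eq = sample_number_eq_Least[OF assms, of \<gamma> x]
  have "?P n" using assms by simp
  then have P: "?P (sample_number \<gamma> n x)" and "sample_number \<gamma> n x \<le> n"
    unfolding eq by (rule LeastI, rule Least_le)
  then show "1 \<le> sample_number \<gamma> n x" "sample_number \<gamma> n x \<le> n"
    "sample_number \<gamma> n x < n \<Longrightarrow> real \<gamma> \<le> sample_sum \<gamma> n x"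
    by (auto simp: sample_sum_def)
qed

text \<open>The estimator with and without the minimum has the same nonzero denominator, so equality
  of the quotients makes the minimum equal to the sum.\<close>

lemma sample_sum_le_threshold:
  assumes "n \<ge> 1" "\<gamma> \<ge> 1" "\<And>i. i \<ge> 1 \<Longrightarrow> x i \<in> {0, 1}"
  shows "sample_sum \<gamma> n x \<le> real \<gamma>"
  using trunc_inv_estimator_eq[of \<gamma> x n, OF assms(2,3)] sample_number_bounds(1)[OF assms(1), of \<gamma> x]
  by (simp add: trunc_inv_estimator_def)

lemma partial_sum_mono:
  fixes x :: "nat \<Rightarrow> real"
  assumes "\<And>i. i \<ge> 1 \<Longrightarrow> x i \<in> {0, 1}" "l \<le> m"
  shows "(\<Sum>i=1..l. x i) \<le> (\<Sum>i=1..m. x i)"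
proof (rule sum_mono2)
  fix i assume "i \<in> {1..m} - {1..l}"
  then show "0 \<le> x i" using assms(1)[of i] by auto
qed (use assms(2) in auto)

lemma trunc_inv_estimator_nonneg:
  assumes "\<And>i. i \<ge> 1 \<Longrightarrow> x i \<in> {0, 1}"
  shows "0 \<le> trunc_inv_estimator \<gamma> n x"
  using partial_sum_mono[of x 0 "sample_number \<gamma> n x", OF assms]
  by (simp add: trunc_inv_estimator_def sample_sum_def)

text \<open>If \<open>n * z \<le> \<gamma>\<close>, stopping early already yields
  \<open>\<gamma>\<close> successes, which is enough. If \<open>\<gamma> < n * z\<close>, reaching
  \<open>n\<close> would need more than \<open>\<gamma>\<close> successes; so sampling stops early,
  and its \<open>\<gamma>\<close> successes fall within the first \<open>\<gamma> / z\<close>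
  samples.\<close>

lemma estimator_ge_imp_partial_sum_ge:
  assumes n: "n \<ge> 1" and \<gamma>: "\<gamma> \<ge> 1" and x: "\<And>i. i \<ge> 1 \<Longrightarrow> x i \<in> {0, 1}"
    and z: "0 < z" and ge: "z \<le> trunc_inv_estimator \<gamma> n x"
  shows "real n * z \<le> real \<gamma> \<Longrightarrow> real n * z \<le> (\<Sum>i=1..n. x i)"
    and "real \<gamma> < real n * z \<Longrightarrow> real \<gamma> \<le> (\<Sum>i=1..nat \<lfloor>real \<gamma> / z\<rfloor>. x i)"
proof -
  define N where "N = sample_number \<gamma> n x"
  note props = sample_number_bounds[OF n, of \<gamma> x, folded N_def]
  have K: "sample_sum \<gamma> n x = (\<Sum>i=1..N. x i)"
    by (simp add: sample_sum_def N_def)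
  have ge': "z * real N \<le> (\<Sum>i=1..N. x i)"
    using ge props(1) trunc_inv_estimator_eq[of \<gamma> x n, OF \<gamma> x]
    by (simp add: K N_def[symmetric] field_simps)
  have le: "(\<Sum>i=1..N. x i) \<le> real \<gamma>"
    using sample_sum_le_threshold[of n \<gamma> x, OF n \<gamma> x] K by simp
  show "real n * z \<le> (\<Sum>i=1..n. x i)" if "real n * z \<le> real \<gamma>"
  proof (cases "N = n")
    case True
    then show ?thesis using ge' by (simp add: mult.commute)
  next
    case False
    then have "real \<gamma> \<le> (\<Sum>i=1..N. x i)" using props K by simp
    also have "\<dots> \<le> (\<Sum>i=1..n. x i)" by (rule partial_sum_mono[OF x props(2)])
    finally show ?thesis using that by simp
  qed
  show "real \<gamma> \<le> (\<Sum>i=1..nat \<lfloor>real \<gamma> / z\<rfloor>. x i)" if lt: "real \<gamma> < real n * z"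
  proof -
    have "N < n" using props(2) ge' le lt by (cases "N = n") (auto simp: mult.commute)
    then have "real \<gamma> \<le> (\<Sum>i=1..N. x i)" using props K by simp
    also have "real N \<le> real \<gamma> / z" using ge' le z by (simp add: field_simps)
    then have "N \<le> nat \<lfloor>real \<gamma> / z\<rfloor>" by (simp add: le_nat_floor)
    then have "(\<Sum>i=1..N. x i) \<le> (\<Sum>i=1..nat \<lfloor>real \<gamma> / z\<rfloor>. x i)"
      by (intro partial_sum_mono[of x, OF x])
    finally show ?thesis .
  qed
qed

text \<open>If \<open>n * z \<le> \<gamma>\<close>, an early stop would give
  \<open>\<gamma> \<le> z * N < z * n\<close>, so all \<open>n\<close> samples are taken. Otherwise
  at least \<open>\<gamma> / z\<close> samples are taken whether or not sampling stops early, and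
  their total never exceeds \<open>\<gamma>\<close>. The level \<open>z = 0\<close> falls under the
  first case.\<close>

lemma estimator_le_imp_partial_sum_le:
  assumes n: "n \<ge> 1" and \<gamma>: "\<gamma> \<ge> 1" and x: "\<And>i. i \<ge> 1 \<Longrightarrow> x i \<in> {0, 1}"
    and z: "0 \<le> z" and le_z: "trunc_inv_estimator \<gamma> n x \<le> z"
  shows "real n * z \<le> real \<gamma> \<Longrightarrow> (\<Sum>i=1..n. x i) \<le> real n * z"
    and "real \<gamma> < real n * z \<Longrightarrow> (\<Sum>i=1..nat \<lceil>real \<gamma> / z\<rceil>. x i) \<le> real \<gamma>"
proof -
  define N where "N = sample_number \<gamma> n x"
  note props = sample_number_bounds[OF n, of \<gamma> x, folded N_def]
  have K: "sample_sum \<gamma> n x = (\<Sum>i=1..N. x i)"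
    by (simp add: sample_sum_def N_def)
  have le': "(\<Sum>i=1..N. x i) \<le> z * real N"
    using le_z props(1) trunc_inv_estimator_eq[of \<gamma> x n, OF \<gamma> x]
    by (simp add: K N_def[symmetric] field_simps)
  have le: "(\<Sum>i=1..N. x i) \<le> real \<gamma>"
    using sample_sum_le_threshold[of n \<gamma> x, OF n \<gamma> x] K by simp
  show "(\<Sum>i=1..n. x i) \<le> real n * z" if "real n * z \<le> real \<gamma>"
  proof (cases "N = n")
    case True
    then show ?thesis using le' by (simp add: mult.commute)
  next
    case False
    then have "real \<gamma> \<le> z * real N" using props K le' by simp
    moreover from this have "0 < z" using z \<gamma> by (cases "z = 0") auto
    then have "z * real N < z * real n" using False props(2) by simp
    ultimately show ?thesis using that by (simp add: mult.commute)
  qed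
  show "(\<Sum>i=1..nat \<lceil>real \<gamma> / z\<rceil>. x i) \<le> real \<gamma>" if lt: "real \<gamma> < real n * z"
  proof -
    have z0: "0 < z" using lt z by (cases "z = 0") auto
    have "real \<gamma> / z \<le> real N"
    proof (cases "N = n")
      case True
      then show ?thesis using lt z0 by (simp add: field_simps)
    next
      case False
      then have "real \<gamma> \<le> z * real N" using props K le' by simp
      then show ?thesis using z0 by (simp add: field_simps)
    qed
    then have "nat \<lceil>real \<gamma> / z\<rceil> \<le> N" by (simp add: nat_le_iff ceiling_le_iff)
    then have "(\<Sum>i=1..nat \<lceil>real \<gamma> / z\<rceil>. x i) \<le> (\<Sum>i=1..N. x i)"
      by (intro partial_sum_mono[of x, OF x])
    with le show ?thesis by simp
  qed
qed

section \<open>Inequalities for the Bernoulli log moment generating function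
  \<open>ln (1 + p * (exp s - 1))\<close>\<close>

lemma bernoulli_mgf_pos:
  fixes p s :: real
  assumes "0 < p" "p < 1"
  shows "0 < 1 + p * (exp s - 1)"
proof -
  have "1 + p * (exp s - 1) = (1 - p) + p * exp s" by (simp add: algebra_simps)
  also have "\<dots> > 0" using assms by (intro add_pos_pos) auto
  finally show ?thesis .
qed

text \<open>Concavity of \<open>ln\<close> on the segment from \<open>1\<close> to
  \<open>1 + q * c\<close>, with weight \<open>p / q\<close>. The sign of \<open>c\<close> is free,
  so that \<open>c = exp t - 1\<close> and \<open>c = exp (- t) - 1\<close> are both
  covered.\<close>

lemma ln_one_plus_cross_mult:
  fixes p q c :: real
  assumes "0 < p" "p \<le> q" "0 < 1 + q * c"
  shows "p * ln (1 + q * c) \<le> q * ln (1 + p * c)"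
proof -
  have "(1 - p / q) * ln 1 + p / q * ln (1 + q * c) \<le> ln ((1 - p / q) * 1 + p / q * (1 + q * c))"
    using concave_onD[OF ln_concave, of "p / q" 1 "1 + q * c"] assms by simp
  also have "(1 - p / q) * 1 + p / q * (1 + q * c) = 1 + p * c"
    using assms by (simp add: field_simps)
  finally have "p / q * ln (1 + q * c) \<le> ln (1 + p * c)" by simp
  then show ?thesis using assms by (simp add: field_simps)
qed

text \<open>The log odds \<open>ln u - ln (1 - u)\<close> have derivative
  \<open>1 / (u * (1 - u))\<close>, which decreases up to \<open>1 / 2\<close>; its value at
  \<open>q\<close> therefore bounds the growth from \<open>q\<close> to \<open>z\<close>.\<close>

lemma ln_odds_ratio_le:
  fixes q z :: real
  assumes "0 < q" "q \<le> z" "z \<le> 1 / 2"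
  shows "ln (z * (1 - q) / (q * (1 - z))) \<le> (z - q) / (q * (1 - q))"
proof -
  define h where "h u = (u - q) / (q * (1 - q)) - (ln u - ln (1 - u))" for u
  have "h q \<le> h z"
  proof (rule DERIV_nonneg_imp_nondecreasing[OF assms(2)])
    fix u assume u: "q \<le> u" "u \<le> z"
    have u01: "0 < u" "u < 1" "q < 1" using u assms by auto
    have "(h has_real_derivative 1 / (q * (1 - q)) - 1 / (u * (1 - u))) (at u)"
      unfolding h_def using u01 assms
      by (auto intro!: derivative_eq_intros simp: divide_simps)
    moreover have "q * (1 - q) \<le> u * (1 - u)"
    proof -
      have "u * (1 - u) - q * (1 - q) = (u - q) * (1 - u - q)" by (simp add: algebra_simps)
      also have "\<dots> \<ge> 0" using u assms by (intro mult_nonneg_nonneg) auto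
      finally show ?thesis by simp
    qed
    then have "1 / (u * (1 - u)) \<le> 1 / (q * (1 - q))"
      using u01 assms by (intro divide_left_mono) auto
    ultimately show "\<exists>y. (h has_real_derivative y) (at u) \<and> 0 \<le> y" by force
  qed
  then show ?thesis using assms by (simp add: h_def ln_div ln_mult)
qed

text \<open>As a function of \<open>p\<close>, \<open>ln (1 + p * c)\<close> lies below its tangent
  at \<open>q\<close>, whose slope is at least \<open>t\<close>. Moving from \<open>q\<close> down
  to \<open>p\<close> thus lowers the logarithm by at least the loss \<open>t * (q - p)\<close> in
  the linear term.\<close>

lemma bernoulli_rate_shift:
  fixes p q c t \<epsilon> :: real
  assumes "0 < 1 + p * c" "0 < 1 + q * c" "p \<le> q" "t \<le> c / (1 + q * c)"
  shows "t * (q + \<epsilon>) - ln (1 + q * c) \<le> t * (p + \<epsilon>) - ln (1 + p * c)"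
proof -
  have "ln (1 + p * c) - ln (1 + q * c) = ln ((1 + p * c) / (1 + q * c))"
    using assms by (simp add: ln_div)
  also have "\<dots> \<le> (1 + p * c) / (1 + q * c) - 1"
    using assms by (intro ln_le_minus_one) simp
  also have "\<dots> = - (q - p) * (c / (1 + q * c))" using assms by (simp add: field_simps)
  also have "\<dots> \<le> - (q - p) * t"
    using assms by (intro mult_left_mono_neg) auto
  finally show ?thesis by (simp add: algebra_simps)
qed

text \<open>At equal deviation and equal \<open>t\<close>, this makes the lower tail exponent at
  least the upper one. With \<open>a = exp u\<close> and \<open>b = exp (- u)\<close>, the
  derivative of the difference has the sign of \<open>(1 - p) * (1 - 2 * p) * (a + b - 2)\<close>,
  and \<open>a * b = 1\<close> forces \<open>a + b \<ge> 2\<close>.\<close>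

lemma bernoulli_mgf_skew:
  fixes p t :: real
  assumes p: "0 < p" "p \<le> 1 / 2" and t: "0 \<le> t"
  shows "2 * t * p \<le> ln (1 + p * (exp t - 1)) - ln (1 + p * (exp (- t) - 1))"
proof -
  define F where "F u = ln (1 + p * (exp u - 1)) - ln (1 + p * (exp (- u) - 1)) - 2 * u * p" for u
  have pos: "0 < 1 + p * (exp u - 1)" for u using bernoulli_mgf_pos[of p u] p by simp
  have "F 0 \<le> F t"
  proof (rule DERIV_nonneg_imp_nondecreasing[OF t])
    fix u :: real assume "0 \<le> u"
    define a b where "a = exp u" and "b = exp (- u)"
    have ab: "a * b = 1" unfolding a_def b_def by (simp add: exp_minus)
    have pa: "0 < 1 + p * (a - 1)" and pb: "0 < 1 + p * (b - 1)"
      unfolding a_def b_def by (rule pos)+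
    have "(F has_real_derivative p * a / (1 + p * (a - 1)) + p * b / (1 + p * (b - 1)) - 2 * p) (at u)"
      unfolding F_def a_def b_def using pos[of u] pos[of "-u"]
      by (auto intro!: derivative_eq_intros simp: mult.commute)
    moreover have "0 \<le> p * a / (1 + p * (a - 1)) + p * b / (1 + p * (b - 1)) - 2 * p"
    proof -
      have combine: "p * ((a * B + b * A - 2 * (A * B)) / (A * B)) = p * a / A + p * b / B - 2 * p"
        if "0 < A" "0 < B" for A B :: real
        using that by (simp add: field_simps)
      have "2 \<le> a + b"
      proof -
        have "0 \<le> (a - 1)\<^sup>2 * b" by (simp add: b_def)
        also have "\<dots> = a * (a * b) - 2 * (a * b) + b" by (simp add: power2_eq_square algebra_simps)
        finally show ?thesis by (simp add: ab)
      qed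
      have "a * (1 + p * (b - 1)) + b * (1 + p * (a - 1)) - 2 * ((1 + p * (a - 1)) * (1 + p * (b - 1)))
        = (1 - p) * (a + b) + 2 * p * (a * b)
          - 2 * ((1 - p)\<^sup>2 + p * (1 - p) * (a + b) + p\<^sup>2 * (a * b))"
        by (simp add: power2_eq_square algebra_simps)
      also have "\<dots> = (1 - p) * (1 - 2 * p) * (a + b - 2)"
        unfolding ab by (simp add: power2_eq_square algebra_simps)
      also have "\<dots> \<ge> 0" using p \<open>2 \<le> a + b\<close> by (intro mult_nonneg_nonneg) auto
      finally have "0 \<le> p * ((a * (1 + p * (b - 1)) + b * (1 + p * (a - 1))
          - 2 * ((1 + p * (a - 1)) * (1 + p * (b - 1)))) / ((1 + p * (a - 1)) * (1 + p * (b - 1))))"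
        using p pa pb by simp
      also have "\<dots> = p * a / (1 + p * (a - 1)) + p * b / (1 + p * (b - 1)) - 2 * p"
        using pa pb by (rule combine)
      finally show ?thesis .
    qed
    ultimately show "\<exists>y. (F has_real_derivative y) (at u) \<and> 0 \<le> y" by blast
  qed
  then show ?thesis by (simp add: F_def)
qed

text \<open>\<open>- M_B z q\<close> is the relative entropy of the Bernoulli laws with parameters
  \<open>z\<close> and \<open>q\<close>. Bounding each logarithm by \<open>x - 1\<close> leaves
  terms that cancel, and the first bound is strict because \<open>q / z < 1\<close>.\<close>

lemma M_B_neg:
  assumes "0 < q" "q < z" "z < 1"
  shows "M_B z q < 0"
proof -
  have "ln (q / z) < q / z - 1"
    using ln_le_minus_one[of "q / z"] ln_eq_minus_one[of "q / z"] assms by fastforce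
  then have "z * ln (q / z) < z * (q / z - 1)" using assms by (intro mult_strict_left_mono) auto
  moreover have "(1 - z) * ln ((1 - q) / (1 - z)) \<le> (1 - z) * ((1 - q) / (1 - z) - 1)"
    using assms by (intro mult_left_mono ln_le_minus_one) auto
  moreover have "z * (q / z - 1) + (1 - z) * ((1 - q) / (1 - z) - 1) = 0"
    using assms by (simp add: field_simps)
  ultimately show ?thesis unfolding M_B_def by linarith
qed

lemma bernoulli_mgf_odds_ratio:
  fixes q z :: real
  assumes "0 < q" "q < 1" "0 < z" "z < 1"
  shows "1 + q * (z * (1 - q) / (q * (1 - z)) - 1) = (1 - q) / (1 - z)"
  using assms by (simp add: field_simps)

text \<open>The log odds ratio is the stationary point in \<open>s\<close> of
  \<open>s * z - ln (1 + q * (exp s - 1))\<close>.\<close>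

lemma M_B_eq_rate:
  assumes "0 < q" "q < 1" "0 < z" "z < 1"
    and t: "t = ln (z * (1 - q) / (q * (1 - z)))"
  shows "t * z - ln (1 + q * (exp t - 1)) = - M_B z q"
proof -
  have "exp t = z * (1 - q) / (q * (1 - z))" using assms by simp
  then have "1 + q * (exp t - 1) = (1 - q) / (1 - z)"
    using bernoulli_mgf_odds_ratio[of q z] assms by simp
  then show ?thesis
    using assms unfolding M_B_def t by (simp add: ln_mult_pos ln_div) (simp add: algebra_simps)
qed


section \<open>Chernoff bounds for the partial sums and for the estimator\<close>

locale bernoulli_samples = prob_space M for M :: "'a measure" +
  fixes X :: "nat \<Rightarrow> 'a \<Rightarrow> real" and p :: real
  assumes p01: "0 < p" "p < 1"
    and indep: "indep_vars (\<lambda>_. borel) X {1..}"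
    and prob_1: "\<And>i. i \<ge> 1 \<Longrightarrow> \<P>(\<omega> in M. X i \<omega> = 1) = p"
    and prob_0: "\<And>i. i \<ge> 1 \<Longrightarrow> \<P>(\<omega> in M. X i \<omega> = 0) = 1 - p"
begin

lemma X_measurable: "i \<ge> 1 \<Longrightarrow> X i \<in> borel_measurable M"
  using indep by (auto simp: indep_vars_def)

text \<open>The probabilities of the values 1 and 0 add up to 1, so other values occur only on a
  null set. Pathwise facts are therefore transferred almost everywhere, for all indices at
  once.\<close>

lemma AE_X_01: "AE \<omega> in M. \<forall>i\<ge>1. X i \<omega> \<in> {0, 1}"
proof -
  have "AE \<omega> in M. i \<ge> 1 \<longrightarrow> X i \<omega> \<in> {0, 1}" for i
  proof (cases "i \<ge> 1")
    case True
    note [measurable] = X_measurable[OF True]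
    have "prob {\<omega> \<in> space M. X i \<omega> \<in> {0, 1}}
        = prob ({\<omega> \<in> space M. X i \<omega> = 1} \<union> {\<omega> \<in> space M. X i \<omega> = 0})"
      by (intro arg_cong[where f = prob]) auto
    also have "\<dots> = 1"
      using prob_1[OF True] prob_0[OF True] by (subst finite_measure_Union) auto
    finally have "AE \<omega> in M. X i \<omega> \<in> {0, 1}"
      by (subst (asm) prob_Collect_eq_1) auto
    then show ?thesis by simp
  qed simp
  then show ?thesis by (simp add: AE_all_countable)
qed

lemma expectation_exp:
  assumes i: "i \<ge> 1"
  shows "integrable M (\<lambda>\<omega>. exp (s * X i \<omega>))"
    and "expectation (\<lambda>\<omega>. exp (s * X i \<omega>)) = 1 + p * (exp s - 1)"
proof -
  note [measurable] = X_measurable[OF i]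
  let ?A = "{\<omega> \<in> space M. X i \<omega> = 1}"
  let ?g = "\<lambda>\<omega>. 1 + (exp s - 1) * indicator ?A \<omega> :: real"
  have eq: "AE \<omega> in M. exp (s * X i \<omega>) = ?g \<omega>"
    using AE_X_01 AE_space by eventually_elim (use i in \<open>auto simp: indicator_def\<close>)
  have A: "?A \<in> events" by measurable
  then have ind: "integrable M (indicator ?A :: 'a \<Rightarrow> real)" by (simp add: less_top[symmetric])
  then have int: "integrable M ?g" by (intro Bochner_Integration.integrable_add integrable_mult_right) auto
  show "integrable M (\<lambda>\<omega>. exp (s * X i \<omega>))"
    by (rule integrable_cong_AE_imp[OF int]) (use eq in auto)
  have "expectation (\<lambda>\<omega>. exp (s * X i \<omega>)) = expectation ?g"
    by (rule integral_cong_AE) (use eq in auto)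
  also have "\<dots> = 1 + p * (exp s - 1)"
    using prob_1[OF i] A ind by (simp add: prob_space mult.commute)
  finally show "expectation (\<lambda>\<omega>. exp (s * X i \<omega>)) = 1 + p * (exp s - 1)" .
qed

lemma partial_sum_measurable [measurable]: "(\<lambda>\<omega>. \<Sum>i=1..m. X i \<omega>) \<in> borel_measurable M"
  by (intro borel_measurable_sum X_measurable) auto

text \<open>Markov's inequality for the exponential of the sum. The factor \<open>s\<close> stays
  inside the event, so a positive \<open>s\<close> gives the upper tail and a negative
  \<open>s\<close> the lower tail.\<close>

lemma chernoff_partial_sum:
  "prob {\<omega> \<in> space M. s * a \<le> s * (\<Sum>i=1..m. X i \<omega>)} \<le> exp (- s * a) * (1 + p * (exp s - 1)) ^ m"
proof -
  have ind: "indep_vars (\<lambda>_. borel) (\<lambda>i \<omega>. exp (s * X i \<omega>)) {1..m}"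
    by (rule indep_vars_compose2[OF indep_vars_subset[OF indep]]) auto
  have prod: "(\<lambda>\<omega>. exp (s * (\<Sum>i=1..m. X i \<omega>))) = (\<lambda>\<omega>. \<Prod>i=1..m. exp (s * X i \<omega>))"
    by (simp add: sum_distrib_left exp_sum)
  have int: "integrable M (\<lambda>\<omega>. exp (s * (\<Sum>i=1..m. X i \<omega>)))"
    unfolding prod by (rule indep_vars_integrable[OF _ ind]) (auto intro: expectation_exp)
  have "prob {\<omega> \<in> space M. s * a \<le> s * (\<Sum>i=1..m. X i \<omega>)}
      = prob {\<omega> \<in> space M. exp (s * a) \<le> exp (s * (\<Sum>i=1..m. X i \<omega>))}"
    by simp
  also have "\<dots> \<le> expectation (\<lambda>\<omega>. exp (s * (\<Sum>i=1..m. X i \<omega>))) / exp (s * a)"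
    by (rule integral_Markov_inequality_measure[OF int, of "{}"]) auto
  also have "expectation (\<lambda>\<omega>. exp (s * (\<Sum>i=1..m. X i \<omega>))) = (1 + p * (exp s - 1)) ^ m"
    unfolding prod by (subst indep_vars_lebesgue_integral[OF _ ind]) (auto simp: expectation_exp)
  finally show ?thesis by (simp add: exp_minus field_simps)
qed

abbreviation estimator :: "nat \<Rightarrow> nat \<Rightarrow> 'a \<Rightarrow> real" where
  "estimator \<gamma> n \<omega> \<equiv> trunc_inv_estimator \<gamma> n (\<lambda>i. X i \<omega>)"

lemma estimator_measurable:
  assumes n: "n \<ge> 1"
  shows "estimator \<gamma> n \<in> borel_measurable M"
proof -
  have [measurable]: "(\<lambda>\<omega>. sample_number \<gamma> n (\<lambda>i. X i \<omega>)) \<in> M \<rightarrow>\<^sub>M count_space UNIV"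
    unfolding sample_number_eq_Least[OF n] by measurable
  \<comment> \<open>The number of summands is random, but takes only countably many values.\<close>
  have [measurable]: "(\<lambda>\<omega>. sample_sum \<gamma> n (\<lambda>i. X i \<omega>)) \<in> borel_measurable M"
    unfolding sample_sum_def
    by (rule measurable_compose_countable[where f = "\<lambda>l \<omega>. \<Sum>i=1..l. X i \<omega>"],
        rule partial_sum_measurable, measurable)
  show ?thesis unfolding trunc_inv_estimator_def by measurable
qed

lemma mgf_power:
  "(1 + p * (exp s - 1)) ^ m = exp (real m * ln (1 + p * (exp s - 1)))"
  using bernoulli_mgf_pos[OF p01, of s] by (simp add: exp_of_nat_mult)

text \<open>\<open>r\<close> is the Chernoff exponent per sample at level \<open>z\<close>. The two
  conditions on \<open>L\<close> belong to the two effective sample sizes \<open>n\<close> and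
  \<open>\<gamma> / z\<close>.\<close>

lemma prob_estimator_ge:
  assumes n: "n \<ge> 1" and \<gamma>: "\<gamma> \<ge> 1" and t: "0 \<le> t" and z: "0 < z"
    and r: "r = t * z - ln (1 + p * (exp t - 1))" and L: "L < real n * r" "L * z < real \<gamma> * r"
  shows "prob {\<omega> \<in> space M. z \<le> estimator \<gamma> n \<omega>} < exp (- L)"
proof (cases "real n * z \<le> real \<gamma>")
  case True
  have "prob {\<omega> \<in> space M. z \<le> estimator \<gamma> n \<omega>}
      \<le> prob {\<omega> \<in> space M. t * (real n * z) \<le> t * (\<Sum>i=1..n. X i \<omega>)}"
  proof (rule finite_measure_mono_AE)
    show "AE \<omega> in M. \<omega> \<in> {\<omega> \<in> space M. z \<le> estimator \<gamma> n \<omega>} \<longrightarrow>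
        \<omega> \<in> {\<omega> \<in> space M. t * (real n * z) \<le> t * (\<Sum>i=1..n. X i \<omega>)}"
      using AE_X_01
    proof eventually_elim
      case (elim \<omega>)
      with estimator_ge_imp_partial_sum_ge(1)[OF n \<gamma> _ z _ True, of "\<lambda>i. X i \<omega>"] t
      show ?case by (auto intro!: mult_left_mono)
    qed
  qed measurable
  also have "\<dots> \<le> exp (- t * (real n * z)) * (1 + p * (exp t - 1)) ^ n"
    by (rule chernoff_partial_sum)
  also have "\<dots> = exp (- (real n * r))"
    unfolding mgf_power r exp_add[symmetric] by (simp add: algebra_simps)
  also have "\<dots> < exp (- L)" using L by simp
  finally show ?thesis .
next
  case False
  define m where "m = nat \<lfloor>real \<gamma> / z\<rfloor>"
  have m: "real m \<le> real \<gamma> / z" unfolding m_def using z by simp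
  \<comment> \<open>The log moment generating function is nonnegative here, so replacing
    \<open>m\<close> by the larger \<open>\<gamma> / z\<close> only weakens the bound.\<close>
  have "0 \<le> p * (exp t - 1)" using p01 t by simp
  then have l0: "0 \<le> ln (1 + p * (exp t - 1))" by simp
  have "prob {\<omega> \<in> space M. z \<le> estimator \<gamma> n \<omega>}
      \<le> prob {\<omega> \<in> space M. t * real \<gamma> \<le> t * (\<Sum>i=1..m. X i \<omega>)}"
  proof (rule finite_measure_mono_AE)
    show "AE \<omega> in M. \<omega> \<in> {\<omega> \<in> space M. z \<le> estimator \<gamma> n \<omega>} \<longrightarrow>
        \<omega> \<in> {\<omega> \<in> space M. t * real \<gamma> \<le> t * (\<Sum>i=1..m. X i \<omega>)}"
      using AE_X_01
    proof eventually_elim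
      case (elim \<omega>)
      with estimator_ge_imp_partial_sum_ge(2)[OF n \<gamma> _ z, of "\<lambda>i. X i \<omega>"] t False
      show ?case by (auto intro!: mult_left_mono simp: m_def)
    qed
  qed measurable
  also have "\<dots> \<le> exp (- t * real \<gamma>) * (1 + p * (exp t - 1)) ^ m"
    by (rule chernoff_partial_sum)
  also have "\<dots> \<le> exp (- t * real \<gamma> + real \<gamma> / z * ln (1 + p * (exp t - 1)))"
    using mult_right_mono[OF m l0] by (simp add: mgf_power exp_add[symmetric])
  also have "- t * real \<gamma> + real \<gamma> / z * ln (1 + p * (exp t - 1)) = - (real \<gamma> * r / z)"
    using z by (simp add: r field_simps)
  also have "exp (- (real \<gamma> * r / z)) < exp (- L)" using L z by (simp add: field_simps)
  finally show ?thesis .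
qed

lemma prob_estimator_le:
  assumes n: "n \<ge> 1" and \<gamma>: "\<gamma> \<ge> 1" and t: "0 \<le> t" and z: "0 \<le> z"
    and r: "r = - t * z - ln (1 + p * (exp (- t) - 1))"
    and L: "L < real n * r" "L * z < real \<gamma> * r"
  shows "prob {\<omega> \<in> space M. estimator \<gamma> n \<omega> \<le> z} < exp (- L)"
proof (cases "real n * z \<le> real \<gamma>")
  case True
  have "prob {\<omega> \<in> space M. estimator \<gamma> n \<omega> \<le> z}
      \<le> prob {\<omega> \<in> space M. - t * (real n * z) \<le> - t * (\<Sum>i=1..n. X i \<omega>)}"
  proof (rule finite_measure_mono_AE)
    show "AE \<omega> in M. \<omega> \<in> {\<omega> \<in> space M. estimator \<gamma> n \<omega> \<le> z} \<longrightarrow>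
        \<omega> \<in> {\<omega> \<in> space M. - t * (real n * z) \<le> - t * (\<Sum>i=1..n. X i \<omega>)}"
      using AE_X_01
    proof eventually_elim
      case (elim \<omega>)
      with estimator_le_imp_partial_sum_le(1)[OF n \<gamma> _ z _ True, of "\<lambda>i. X i \<omega>"] t
      show ?case by (auto intro!: mult_left_mono)
    qed
  qed measurable
  also have "\<dots> \<le> exp (- (- t) * (real n * z)) * (1 + p * (exp (- t) - 1)) ^ n"
    by (rule chernoff_partial_sum)
  also have "\<dots> = exp (- (real n * r))"
    unfolding mgf_power r exp_add[symmetric] by (simp add: algebra_simps)
  also have "\<dots> < exp (- L)" using L by simp
  finally show ?thesis .
next
  case False
  then have z0: "0 < z" using z by (cases "z = 0") auto
  define m where "m = nat \<lceil>real \<gamma> / z\<rceil>"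
  have m: "real \<gamma> / z \<le> real m" unfolding m_def by (rule real_nat_ceiling_ge)
  \<comment> \<open>With a nonpositive logarithm the rounding must go up: replacing \<open>m\<close>
    by the smaller \<open>\<gamma> / z\<close> weakens the bound.\<close>
  have "1 + p * (exp (- t) - 1) \<le> 1" using p01 t by (simp add: mult_nonneg_nonpos)
  then have l0: "ln (1 + p * (exp (- t) - 1)) \<le> 0"
    using bernoulli_mgf_pos[OF p01, of "- t"] by simp
  have "prob {\<omega> \<in> space M. estimator \<gamma> n \<omega> \<le> z}
      \<le> prob {\<omega> \<in> space M. - t * real \<gamma> \<le> - t * (\<Sum>i=1..m. X i \<omega>)}"
  proof (rule finite_measure_mono_AE)
    show "AE \<omega> in M. \<omega> \<in> {\<omega> \<in> space M. estimator \<gamma> n \<omega> \<le> z} \<longrightarrow>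
        \<omega> \<in> {\<omega> \<in> space M. - t * real \<gamma> \<le> - t * (\<Sum>i=1..m. X i \<omega>)}"
      using AE_X_01
    proof eventually_elim
      case (elim \<omega>)
      with estimator_le_imp_partial_sum_le(2)[OF n \<gamma> _ z, of "\<lambda>i. X i \<omega>"] t False
      show ?case by (auto intro!: mult_left_mono simp: m_def)
    qed
  qed measurable
  also have "\<dots> \<le> exp (- (- t) * real \<gamma>) * (1 + p * (exp (- t) - 1)) ^ m"
    by (rule chernoff_partial_sum)
  also have "\<dots> \<le> exp (t * real \<gamma> + real \<gamma> / z * ln (1 + p * (exp (- t) - 1)))"
    using mult_right_mono_neg[OF m l0] by (simp add: mgf_power exp_add[symmetric])
  also have "t * real \<gamma> + real \<gamma> / z * ln (1 + p * (exp (- t) - 1)) = - (real \<gamma> * r / z)"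
    using z0 by (simp add: r field_simps)
  also have "exp (- (real \<gamma> * r / z)) < exp (- L)" using L z0 by (simp add: field_simps)
  finally show ?thesis .
qed

lemma prob_estimator_neg:
  assumes "z < 0"
  shows "prob {\<omega> \<in> space M. estimator \<gamma> n \<omega> \<le> z} = 0"
proof -
  have "prob {\<omega> \<in> space M. estimator \<gamma> n \<omega> \<le> z} \<le> prob {}"
  proof (rule finite_measure_mono_AE)
    show "AE \<omega> in M. \<omega> \<in> {\<omega> \<in> space M. estimator \<gamma> n \<omega> \<le> z} \<longrightarrow> \<omega> \<in> {}"
      using AE_X_01
    proof eventually_elim
      case (elim \<omega>)
      with trunc_inv_estimator_nonneg[of "\<lambda>i. X i \<omega>" \<gamma> n] assms show ?case by auto
    qed
  qed simp
  then show ?thesis by (simp add: measure_le_0_iff)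
qed

end

section \<open>Comparison with the exponents at the critical point, and the coverage bound\<close>

text \<open>Here \<open>z = 0\<close> is allowed, so the bounds are stated without division by \<open>z\<close>.\<close>

lemma rate_threshold:
  fixes L r r0 z z0 g m :: real
  assumes "0 \<le> z" "0 < z0" "0 < r0" "0 \<le> m" "0 < g"
    and "L < m * r0" "L * z0 < g * r0" "r0 \<le> r" "r0 * z \<le> r * z0"
  shows "L < m * r" "L * z < g * r"
proof -
  show "L < m * r" using assms(4,6) mult_left_mono[OF assms(8,4)] by linarith
  show "L * z < g * r"
  proof (cases "z = 0")
    case True
    then show ?thesis using assms by simp
  next
    case False
    have "L * z * z0 = L * z0 * z" by simp
    also have "\<dots> < g * r0 * z" using False assms by (intro mult_strict_right_mono) auto
    also have "\<dots> \<le> g * (r * z0)" using assms by (simp add: mult.assoc)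
    finally have "L * z * z0 < g * r * z0" by (simp add: mult_ac)
    then show ?thesis using assms by simp
  qed
qed

theorem theorem3:
  fixes M :: "'a measure" and X :: "nat \<Rightarrow> 'a \<Rightarrow> real"
    and p \<delta> \<epsilon>\<^sub>a \<epsilon>\<^sub>r pstar :: real and \<gamma> n :: nat
  assumes "prob_space M"
    and "0 < p" and "p < 1"
    and "prob_space.indep_vars M (\<lambda>_. borel) X {1..}"
    and "\<And>i. i \<ge> 1 \<Longrightarrow> \<P>(\<omega> in M. X i \<omega> = 1) = p"
    and "\<And>i. i \<ge> 1 \<Longrightarrow> \<P>(\<omega> in M. X i \<omega> = 0) = 1 - p"
    and "0 < \<delta>" and "\<delta> < 1"
    and "0 < \<epsilon>\<^sub>a" and "\<epsilon>\<^sub>a < \<epsilon>\<^sub>r" and "\<epsilon>\<^sub>r < 1"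
    and "\<epsilon>\<^sub>a / \<epsilon>\<^sub>r + \<epsilon>\<^sub>a \<le> 1 / 2"
    and "pstar = \<epsilon>\<^sub>a / \<epsilon>\<^sub>r"
    and "\<gamma> > 0" and "n > 0"
    and "real n > ln (\<delta> / 2) / M_B (pstar + \<epsilon>\<^sub>a) pstar"
    and "real \<gamma> > ln (\<delta> / 2) / M_I (pstar + \<epsilon>\<^sub>a) pstar"
  defines "phat \<equiv> \<lambda>\<omega>. trunc_inv_estimator \<gamma> n (\<lambda>i. X i \<omega>)"
  shows "\<P>(\<omega> in M. \<bar>phat \<omega> - p\<bar> < \<epsilon>\<^sub>a \<or> \<bar>(phat \<omega> - p) / p\<bar> < \<epsilon>\<^sub>r) > 1 - \<delta>"
proof -
  interpret bernoulli_samples M X p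
    unfolding bernoulli_samples_def bernoulli_samples_axioms_def using assms(1-6) by blast
  define q z0 where "q = pstar" and "z0 = q + \<epsilon>\<^sub>a"
  define t where "t = ln (z0 * (1 - q) / (q * (1 - z0)))"
  define r0 where "r0 = - M_B z0 q"
  define L where "L = - ln (\<delta> / 2)"
  have \<epsilon>r: "0 < \<epsilon>\<^sub>r" using assms by linarith
  have q: "0 < q" "q < z0" "z0 \<le> 1 / 2" "q * \<epsilon>\<^sub>r = \<epsilon>\<^sub>a"
    using assms \<epsilon>r by (auto simp: q_def z0_def)
  have n: "n \<ge> 1" and \<gamma>: "\<gamma> \<ge> 1" using assms by auto
  have r0: "r0 = t * z0 - ln (1 + q * (exp t - 1))"
    unfolding r0_def using M_B_eq_rate[of q z0 t] q t_def by simp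
  have r0_pos: "0 < r0" using M_B_neg[of q z0] q by (simp add: r0_def)
  have exp_t: "exp t = z0 * (1 - q) / (q * (1 - z0))" using q by (simp add: t_def)
  have t_pos: "0 \<le> t"
    unfolding t_def using q by (intro ln_ge_zero) (simp add: field_simps)
  have exp_L: "exp (- L) = \<delta> / 2" using assms by (simp add: L_def)
  \<comment> \<open>Since \<open>M_B\<close> is negative, the hypotheses on \<open>n\<close> and
    \<open>\<gamma>\<close> read \<open>n > L / r0\<close> and
    \<open>\<gamma> > L * z0 / r0\<close>.\<close>
  have Ln: "L < real n * r0"
    using assms(16) r0_pos by (simp add: L_def r0_def q_def z0_def field_simps)
  have L\<gamma>: "L * z0 < real \<gamma> * r0"
    using assms(17) r0_pos q unfolding M_I_def q_def[symmetric] z0_def[symmetric]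
    by (simp add: L_def r0_def field_simps)
  note pos_p = bernoulli_mgf_pos[OF p01]
  have pos_q: "0 < 1 + q * (exp s - 1)" for s using bernoulli_mgf_pos[of q s] q by simp
  \<comment> \<open>By the choice of \<open>t\<close>, the tangent slope on the right equals
    \<open>(z0 - q) / (q * (1 - q))\<close>, the bound of \<open>ln_odds_ratio_le\<close>.\<close>
  have t_le: "t \<le> (exp t - 1) / (1 + q * (exp t - 1))"
  proof -
    have "t \<le> (z0 - q) / (q * (1 - q))"
      unfolding t_def using q by (intro ln_odds_ratio_le) auto
    also have "\<dots> = (exp t - 1) / (1 + q * (exp t - 1))"
      unfolding exp_t using bernoulli_mgf_odds_ratio[of q z0] q
      by (simp add: divide_simps) (simp add: algebra_simps)
    finally show ?thesis .
  qed
  \<comment> \<open>The two error criteria combine to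
    \<open>\<bar>phat \<omega> - p\<bar> < d\<close>. The maximum changes branch at
    \<open>p = q\<close>, where \<open>q * \<epsilon>\<^sub>r = \<epsilon>\<^sub>a\<close>.\<close>
  define d where "d = max \<epsilon>\<^sub>a (\<epsilon>\<^sub>r * p)"
  have d_small: "d = \<epsilon>\<^sub>a" if "p \<le> q"
    using mult_right_mono[OF that less_imp_le[OF \<epsilon>r]] q(4)
    unfolding d_def by (intro max_absorb1) (metis mult.commute)
  have d_large: "d = \<epsilon>\<^sub>r * p" if "q \<le> p"
    using mult_right_mono[OF that less_imp_le[OF \<epsilon>r]] q(4)
    unfolding d_def by (intro max_absorb2) (metis mult.commute)
  have d_pos: "0 < d" using assms by (simp add: d_def)

  define rp where "rp = t * (p + d) - ln (1 + p * (exp t - 1))"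
  define rm where "rm = - t * (p - d) - ln (1 + p * (exp (- t) - 1))"

  \<comment> \<open>Both the exponent per sample and its quotient by the level must be at least as
    large as at \<open>q\<close>; these are the hypotheses of \<open>rate_threshold\<close>.\<close>
  have up: "r0 \<le> rp \<and> r0 * (p + d) \<le> rp * z0"
  proof (cases "p \<le> q")
    case True
    have "r0 \<le> rp" unfolding r0 rp_def d_small[OF True] z0_def
      by (rule bernoulli_rate_shift) (use pos_p pos_q True t_le in auto)
    moreover have "r0 * (p + d) \<le> rp * z0"
      using True d_small q r0_pos p01 d_pos \<open>r0 \<le> rp\<close> by (intro mult_mono) (auto simp: z0_def)
    ultimately show ?thesis ..
  next
    case False
    then have d: "d = \<epsilon>\<^sub>r * p" using d_large by simp
    have z0_eq: "z0 = q * (1 + \<epsilon>\<^sub>r)" using q by (simp add: z0_def algebra_simps)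
    \<comment> \<open>The linear terms of both sides agree. As
      \<open>p + d = p * (1 + \<epsilon>\<^sub>r)\<close>, multiplying by
      \<open>1 + \<epsilon>\<^sub>r\<close> gives the second claim, and \<open>q < p\<close> gives
      the first.\<close>
    have le: "r0 * p \<le> rp * q"
    proof -
      have "r0 * p = p * q * t * (1 + \<epsilon>\<^sub>r) - p * ln (1 + q * (exp t - 1))"
        unfolding r0 by (simp add: z0_eq algebra_simps)
      moreover have "rp * q = p * q * t * (1 + \<epsilon>\<^sub>r) - q * ln (1 + p * (exp t - 1))"
        by (simp add: rp_def d algebra_simps)
      ultimately show ?thesis
        using ln_one_plus_cross_mult[of q p "exp t - 1"] False q(1) pos_p[of t] by simp
    qed
    have "r0 * q \<le> r0 * p" using False r0_pos by simp
    with le have "r0 * q \<le> rp * q" by linarith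
    then have "r0 \<le> rp" using q(1) by simp
    moreover have "r0 * p * (1 + \<epsilon>\<^sub>r) \<le> rp * q * (1 + \<epsilon>\<^sub>r)"
      using le \<epsilon>r by (intro mult_right_mono) auto
    ultimately show ?thesis by (simp add: d z0_eq algebra_simps)
  qed
  have dn: "r0 \<le> rm \<and> r0 * (p - d) \<le> rm * z0" if "0 \<le> p - d"
  proof (cases "p \<le> q")
    case True
    have "rp \<le> rm"
      using bernoulli_mgf_skew[of p t] True q p01 t_pos by (simp add: rp_def rm_def algebra_simps)
    with up have "r0 \<le> rm" by simp
    moreover have "r0 * (p - d) \<le> rm * z0"
      using \<open>r0 \<le> rm\<close> that True q r0_pos d_pos by (intro mult_mono) auto
    ultimately show ?thesis ..
  next
    case False
    then have d: "d = \<epsilon>\<^sub>r * p" using d_large by simp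
    have z0_eq: "z0 = q * (1 + \<epsilon>\<^sub>r)" using q by (simp add: z0_def algebra_simps)
    \<comment> \<open>Here \<open>p\<close> may exceed \<open>1 / 2\<close>, so the skewness bound
      is applied at \<open>q\<close> and the resulting lower tail exponent is then carried over from
      \<open>q\<close> to \<open>p\<close>.\<close>
    define rq where "rq = - t * (q - \<epsilon>\<^sub>a) - ln (1 + q * (exp (- t) - 1))"
    have "r0 \<le> rq"
      using bernoulli_mgf_skew[of q t] q t_pos by (simp add: r0 rq_def z0_def algebra_simps)
    then have "r0 * p \<le> rq * p" using p01 by simp
    also have "rq * p \<le> rm * q"
    proof -
      have "rq * p = - p * q * t * (1 - \<epsilon>\<^sub>r) - p * ln (1 + q * (exp (- t) - 1))"
        by (simp add: rq_def q(4)[symmetric] algebra_simps)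
      moreover have "rm * q = - p * q * t * (1 - \<epsilon>\<^sub>r) - q * ln (1 + p * (exp (- t) - 1))"
        by (simp add: rm_def d algebra_simps)
      ultimately show ?thesis
        using ln_one_plus_cross_mult[of q p "exp (- t) - 1"] False q(1) pos_p[of "- t"] by simp
    qed
    finally have le: "r0 * p \<le> rm * q" .
    have "r0 * q \<le> r0 * p" using False r0_pos by simp
    with le have "r0 * q \<le> rm * q" by linarith
    then have "r0 \<le> rm" using q by simp
    have "r0 * p * (1 - \<epsilon>\<^sub>r) \<le> rm * q * (1 + \<epsilon>\<^sub>r)"
      using le \<open>r0 \<le> rm\<close> \<epsilon>r assms(11) r0_pos p01 q by (intro mult_mono[OF le]) auto
    with \<open>r0 \<le> rm\<close> show ?thesis by (simp add: d z0_eq algebra_simps)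
  qed
  have upper: "prob {\<omega> \<in> space M. p + d \<le> phat \<omega>} < \<delta> / 2"
  proof -
    note T = rate_threshold[of "p + d" z0 r0 "real n" "real \<gamma>" L rp]
    show ?thesis unfolding phat_def exp_L[symmetric]
      by (rule prob_estimator_ge[OF n \<gamma> t_pos _ rp_def])
        (use T up p01 d_pos q r0_pos Ln L\<gamma> \<gamma> in auto)
  qed
  have lower: "prob {\<omega> \<in> space M. phat \<omega> \<le> p - d} < \<delta> / 2"
  proof (cases "0 \<le> p - d")
    case True
    note T = rate_threshold[of "p - d" z0 r0 "real n" "real \<gamma>" L rm]
    show ?thesis unfolding phat_def exp_L[symmetric]
      by (rule prob_estimator_le[OF n \<gamma> t_pos True rm_def])
        (use T dn True p01 d_pos q r0_pos Ln L\<gamma> \<gamma> in auto)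
  next
    \<comment> \<open>The level is negative, while the estimator is almost surely
      nonnegative.\<close>
    case False
    then show ?thesis unfolding phat_def using prob_estimator_neg[of "p - d"] assms by simp
  qed
  have [measurable]: "phat \<in> borel_measurable M"
    unfolding phat_def by (rule estimator_measurable[OF n])
  let ?good = "{\<omega> \<in> space M. \<bar>phat \<omega> - p\<bar> < \<epsilon>\<^sub>a \<or> \<bar>(phat \<omega> - p) / p\<bar> < \<epsilon>\<^sub>r}"
  have good: "\<bar>x - p\<bar> < \<epsilon>\<^sub>a \<or> \<bar>(x - p) / p\<bar> < \<epsilon>\<^sub>r \<longleftrightarrow> \<bar>x - p\<bar> < d" for x
    using p01 by (auto simp: d_def less_max_iff_disj abs_divide pos_divide_less_eq)
  have "1 - prob ?good = prob (space M - ?good)"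
    by (rule prob_compl[symmetric]) measurable
  also have "space M - ?good =
      {\<omega> \<in> space M. p + d \<le> phat \<omega>} \<union> {\<omega> \<in> space M. phat \<omega> \<le> p - d}"
    unfolding good by auto
  also have "prob \<dots> \<le> prob {\<omega> \<in> space M. p + d \<le> phat \<omega>} + prob {\<omega> \<in> space M. phat \<omega> \<le> p - d}"
    by (rule measure_Un_le) measurable
  finally show ?thesis using upper lower by simp
qed

end
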